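(* Let $H$ be a separable real Hilbert space, $U\subset H$ a closed subspace, and $Q\in L(H)$ a nonnegative self-adjoint nuclear operator such that $U$ and $U^\perp$ are $Q$-invariant. Consider the statistical model $(\mathbb{P}_\vartheta)_{\vartheta\in\Theta}$ on $H$ with $\Theta=U\times(0,\infty)$ and $\mathbb{P}_\vartheta=\mathrm{N}(\zeta,\sigma^2Q)$ for $\vartheta=(\zeta,\sigma)$, with observation $Y$, and let $\widehat{\zeta}(Y):=\Pi_UY$. Then for each self-adjoint operator $T\in L(H)$ such that $T(Y)$ is an unbiased estimator for $\zeta$ we have $$R_\vartheta[\widehat{\zeta}(Y)]\le R_\vartheta[T(Y)]\quad\text{for all }\vartheta=(\zeta,\sigma)\in\Theta.$$
   Context: $L(H)$ denotes the bounded linear operators on $H$. A subspace $V$ is $Q$-invariant if $Q(V)\subset V$. $\Pi_V$ is the orthogonal projection onto a closed subspace $V$. $\mathrm{N}(\zeta,\sigma^2Q)$ is the Gaussian measure on $H$ with mean $\zeta$ and covariance operator $\sigma^2Q$, i.e. if $Y$ has this law then $\langle b,Y\rangle\sim\mathrm{N}(\langle b,\zeta\rangle,\sigma^2\langle Qb,b\rangle)$ (possibly degenerate) for all $b\in H$. $Y$ is the observation (the identity map on $H$), so $Y\sim\mathrm{N}(\zeta,\sigma^2Q)$ under $\mathbb{P}_\vartheta$, and $\mathbb{E}_\vartheta$ is expectation under $\mathbb{P}_\vartheta$. $T(Y)$ is unbiased for $\zeta$ if $\mathbb{E}_\vartheta[T(Y)]=\zeta$ for all $\vartheta=(\zeta,\sigma)\in\Theta$.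 The risk of an estimator $T(Y)$ of $\zeta$ is $R_\vartheta[T(Y)]:=\mathbb{E}_\vartheta[\|T(Y)-\zeta\|^2]$. *)

theory Defs
  imports "HOL-Probability.Probability"
begin

text \<open>
  A separable real Hilbert space is a type of sort
  \<open>{real_inner, banach, second_countable_topology}\<close> (second countability and separability
  coincide for metric spaces), and \<open>L(H)\<close> is the type of bounded linear functions
  \<open>'a \<Rightarrow>\<^sub>L 'a\<close>.
\<close>

definition self_adjoint :: "('a::real_inner \<Rightarrow>\<^sub>L 'a) \<Rightarrow> bool" where
  "self_adjoint T \<longleftrightarrow> (\<forall>x y. blinfun_apply T x \<bullet> y = x \<bullet> blinfun_apply T y)"

definition nonneg_op :: "('a::real_inner \<Rightarrow>\<^sub>L 'a) \<Rightarrow> bool" where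
  "nonneg_op T \<longleftrightarrow> (\<forall>x. 0 \<le> blinfun_apply T x \<bullet> x)"

definition nuclear_op :: "('a::real_normed_vector \<Rightarrow>\<^sub>L 'a) \<Rightarrow> bool" where
  "nuclear_op T \<longleftrightarrow>
     (\<exists>(\<phi> :: nat \<Rightarrow> 'a \<Rightarrow>\<^sub>L real) (a :: nat \<Rightarrow> 'a).
        summable (\<lambda>j. norm (\<phi> j) * norm (a j)) \<and>
        (\<forall>x. (\<lambda>j. blinfun_apply (\<phi> j) x *\<^sub>R a j) sums blinfun_apply T x))"

definition invariant_under :: "('a::real_normed_vector \<Rightarrow>\<^sub>L 'a) \<Rightarrow> 'a set \<Rightarrow> bool" where
  "invariant_under T V \<longleftrightarrow> blinfun_apply T ` V \<subseteq> V"

text \<open>The point named here exists uniquely when \<open>V\<close> is a closed subspace of a Hilbert space.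
  (The library's \<open>closest_point\<close> is restricted to spaces with the Heine-Borel property.)\<close>

definition orth_proj :: "'a::real_inner set \<Rightarrow> 'a \<Rightarrow> 'a" where
  "orth_proj V x = (THE p. p \<in> V \<and> x - p \<in> orthogonal_comp V)"

text \<open>The normal distribution with mean \<open>m\<close> and variance \<open>v \<ge> 0\<close>, which is the point mass at
  \<open>m\<close> if \<open>v = 0\<close>. The second parameter of \<open>normal_density\<close> is the standard deviation.\<close>

definition normal_dist :: "real \<Rightarrow> real \<Rightarrow> real measure" where
  "normal_dist m v =
     (if v = 0 then return borel m
      else density lborel (\<lambda>x. ennreal (normal_density m (sqrt v) x)))"

text \<open>\<open>M\<close> is the Gaussian measure \<open>N(\<mu>, C)\<close>, which is determined by its one-dimensional
  projections.\<close>

definition gaussian_measure ::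
    "'a::{real_inner, second_countable_topology} measure \<Rightarrow> 'a \<Rightarrow> ('a \<Rightarrow>\<^sub>L 'a) \<Rightarrow> bool" where
  "gaussian_measure M \<mu> C \<longleftrightarrow>
     prob_space M \<and> sets M = sets borel \<and>
     (\<forall>b. distr M borel (\<lambda>y. b \<bullet> y) = normal_dist (b \<bullet> \<mu>) (blinfun_apply C b \<bullet> b))"

text \<open>In the following two definitions the observation \<open>Y\<close> is the identity on the sample space,
  so an estimator \<open>\<delta>(Y)\<close> is the function \<open>\<delta>\<close>. Parameters are pairs \<open>(\<zeta>, \<sigma>)\<close>, and \<open>\<zeta>\<close> is
  estimated. Integrability is required explicitly because the Bochner integral of a
  non-integrable function is \<open>0\<close>; for the same reason the risk takes values in \<open>[0, \<infinity>]\<close>.\<close>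

definition unbiased ::
    "('a \<times> real) set \<Rightarrow> ('a \<times> real \<Rightarrow> 'a measure) \<Rightarrow>
     ('a \<Rightarrow> 'a::{banach, second_countable_topology}) \<Rightarrow> bool" where
  "unbiased \<Theta> P \<delta> \<longleftrightarrow>
     (\<forall>\<theta>\<in>\<Theta>. integrable (P \<theta>) \<delta> \<and> (\<integral>y. \<delta> y \<partial>P \<theta>) = fst \<theta>)"

definition risk ::
    "('a \<times> real \<Rightarrow> 'a measure) \<Rightarrow> 'a \<times> real \<Rightarrow> ('a \<Rightarrow> 'a::real_normed_vector) \<Rightarrow> ennreal" where
  "risk P \<theta> \<delta> = (\<integral>\<^sup>+ y. ennreal ((norm (\<delta> y - fst \<theta>))\<^sup>2) \<partial>P \<theta>)"

end

theory Submission
  imports Defs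
begin

text \<open>
  The inequality between the risks holds already between the losses, for every single
  observation.  Since the mean of \<open>N(\<zeta>, \<sigma>\<^sup>2Q)\<close> is \<open>\<zeta>\<close>, a linear estimator \<open>T\<close> is unbiased
  only if it fixes every point of \<open>U\<close> (\<open>unbiased_linear_estimator_fixes_means\<close>).  If \<open>T\<close> is
  moreover self-adjoint, then \<open>\<langle>T y, u\<rangle> = \<langle>y, T u\<rangle> = \<langle>y, u\<rangle>\<close> for \<open>u \<in> U\<close>, which means that
  \<open>T y\<close> and \<open>y\<close> have the same projection \<open>p\<close> onto \<open>U\<close>.  Therefore
  \<open>T y - \<zeta> = (p - \<zeta>) + (T y - p)\<close> is a sum of a vector of \<open>U\<close> and a vector of \<open>U\<^sup>\<bottom>\<close>, and
  by Pythagoras \<open>\<parallel>T y - \<zeta>\<parallel> \<ge> \<parallel>p - \<zeta>\<parallel>\<close>.  Integration over \<open>y\<close> gives the claim.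

  The projection theorem in a Hilbert space of arbitrary dimension, which makes \<open>p\<close>
  meaningful, is proved by a minimising sequence (\<open>orthogonal_decomposition_exists\<close>).
\<close>

section \<open>Orthogonal projection in a Hilbert space\<close>

text \<open>
  A sequence in \<open>V\<close> whose squared distances to \<open>x\<close> tend to the infimum \<open>D\<close> is Cauchy: the
  midpoint of two of its terms lies in \<open>V\<close> as well, so it cannot be much closer to \<open>x\<close> than
  they are, and the parallelogram law turns this into a bound on their distance.  The limit
  attains \<open>D\<close>, and a minimiser is orthogonal because moving it along a direction \<open>u \<in> V\<close>
  cannot decrease the distance.
\<close>

lemma orthogonal_decomposition_exists:
  fixes V :: "'a::{real_inner, banach} set"
  assumes V: "subspace V" and "closed V"
  shows "\<exists>p\<in>V. x - p \<in> orthogonal_comp V"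
proof -
  define D where "D = (INF v\<in>V. (norm (x - v))\<^sup>2)"
  have bdd: "bdd_below ((\<lambda>v. (norm (x - v))\<^sup>2) ` V)"
    by (intro bdd_belowI[of _ 0]) auto
  have D_le: "D \<le> (norm (x - v))\<^sup>2" if "v \<in> V" for v
    unfolding D_def using bdd that by (rule cINF_lower)
  have "\<exists>v\<in>V. (norm (x - v))\<^sup>2 < D + 1 / real (Suc n)" for n
  proof -
    have "V \<noteq> {}" using subspace_0[OF V] by auto
    moreover have "(INF v\<in>V. (norm (x - v))\<^sup>2) < D + 1 / real (Suc n)"
      unfolding D_def by simp
    ultimately show ?thesis using cINF_less_iff[OF _ bdd] by blast
  qed
  then obtain v where vV: "\<And>n. v n \<in> V"
    and v: "\<And>n. (norm (x - v n))\<^sup>2 < D + 1 / real (Suc n)" by metis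
  have dist_v: "(dist (v m) (v n))\<^sup>2 \<le> 2 / real (Suc m) + 2 / real (Suc n)" for m n
  proof -
    have "(1/2) *\<^sub>R (v m + v n) \<in> V"
      by (intro subspace_scale[OF V] subspace_add[OF V] vV)
    then have "D \<le> (norm (x - (1/2) *\<^sub>R (v m + v n)))\<^sup>2" by (rule D_le)
    moreover have "(dist (v m) (v n))\<^sup>2 =
        2 * (norm (x - v m))\<^sup>2 + 2 * (norm (x - v n))\<^sup>2
        - 4 * (norm (x - (1/2) *\<^sub>R (v m + v n)))\<^sup>2"
      unfolding dist_norm power2_norm_eq_inner
      by (simp add: algebra_simps inner_commute)
    ultimately show ?thesis using v[of m] v[of n] by simp
  qed
  have "Cauchy v"
  proof (rule metric_CauchyI)
    fix e :: real assume "e > 0"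
    then obtain N where N: "1 / real (Suc N) < e\<^sup>2 / 4"
      using nat_approx_posE[of "e\<^sup>2 / 4"] by auto
    have "dist (v m) (v n) < e" if "m \<ge> N" "n \<ge> N" for m n
    proof -
      have "1 / real (Suc k) \<le> 1 / real (Suc N)" if "k \<ge> N" for k
        using that by (simp add: frac_le)
      then have "1 / real (Suc m) \<le> 1 / real (Suc N)" "1 / real (Suc n) \<le> 1 / real (Suc N)"
        using that by blast+
      then have "(dist (v m) (v n))\<^sup>2 < e\<^sup>2"
        using dist_v[of m n] N by simp
      then show ?thesis using \<open>e > 0\<close> by (simp add: power_less_imp_less_base)
    qed
    then show "\<exists>N. \<forall>m\<ge>N. \<forall>n\<ge>N. dist (v m) (v n) < e" by blast
  qed
  then obtain p where p: "v \<longlonglongrightarrow> p"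
    using Cauchy_convergent convergent_def by blast
  have "p \<in> V" using closed_sequentially[OF \<open>closed V\<close> vV p] .
  have p_min: "(norm (x - p))\<^sup>2 \<le> D"
  proof (rule LIMSEQ_le)
    show "(\<lambda>n. (norm (x - v n))\<^sup>2) \<longlonglongrightarrow> (norm (x - p))\<^sup>2"
      by (intro tendsto_intros p)
    show "(\<lambda>n. D + 1 / real (Suc n)) \<longlonglongrightarrow> D"
      using tendsto_add[OF tendsto_const lim_1_over_n[THEN LIMSEQ_Suc]] by simp
    show "\<exists>N. \<forall>n\<ge>N. (norm (x - v n))\<^sup>2 \<le> D + 1 / real (Suc n)"
      using v less_imp_le by blast
  qed
  have "u \<bullet> (x - p) = 0" if "u \<in> V" for u
  proof (cases "u = 0")
    case False
    \<comment> \<open>The step along \<open>u\<close> that decreases the distance to \<open>x\<close> the most.\<close>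
    define t where "t = (u \<bullet> (x - p)) / (u \<bullet> u)"
    have "p + t *\<^sub>R u \<in> V"
      by (intro subspace_add[OF V] subspace_scale[OF V] that \<open>p \<in> V\<close>)
    then have "(norm (x - p))\<^sup>2 \<le> (norm ((x - p) - t *\<^sub>R u))\<^sup>2"
      using D_le[of "p + t *\<^sub>R u"] p_min unfolding diff_diff_add by linarith
    also have "\<dots> = (norm (x - p))\<^sup>2 - 2 * (t * (u \<bullet> (x - p))) + t * (t * (u \<bullet> u))"
      unfolding power2_norm_eq_inner
      by (simp only: inner_diff_left inner_diff_right inner_scaleR_left inner_scaleR_right)
        (simp add: algebra_simps inner_commute)
    also have "t * (u \<bullet> u) = u \<bullet> (x - p)" using False by (simp add: t_def)
    finally have "t * (u \<bullet> (x - p)) \<le> 0" by simp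
    then have "(u \<bullet> (x - p))\<^sup>2 / (u \<bullet> u) \<le> 0"
      by (simp add: t_def power2_eq_square)
    moreover have "u \<bullet> u > 0" using False by simp
    ultimately show ?thesis by (auto simp: divide_le_0_iff simp del: inner_gt_zero_iff)
  qed simp
  with \<open>p \<in> V\<close> show ?thesis by (auto simp: orthogonal_comp_def orthogonal_def)
qed

lemma orth_proj_eqI:
  assumes V: "subspace V" and p: "p \<in> V" "x - p \<in> orthogonal_comp V"
  shows "orth_proj V x = p"
  unfolding orth_proj_def
proof (rule the_equality)
  fix q assume q: "q \<in> V \<and> x - q \<in> orthogonal_comp V"
  \<comment> \<open>The difference of two candidates is orthogonal to itself.\<close>
  then have "q - p \<in> V" using subspace_diff[OF V] p by blast
  then have "(q - p) \<bullet> (x - p) = 0" "(q - p) \<bullet> (x - q) = 0"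
    using p q by (auto simp: orthogonal_comp_def orthogonal_def)
  then have "(q - p) \<bullet> (q - p) = 0" by (simp add: inner_diff_right)
  then show "q = p" by simp
qed (use p in blast)

lemma orth_proj_decomposition:
  fixes V :: "'a::{real_inner, banach} set"
  assumes "subspace V" and "closed V"
  shows "orth_proj V x \<in> V" and "x - orth_proj V x \<in> orthogonal_comp V"
  using orthogonal_decomposition_exists[OF assms, of x] orth_proj_eqI[OF assms(1)] by auto

lemma norm_orth_proj_diff_le:
  fixes V :: "'a::{real_inner, banach} set"
  assumes "subspace V" and "closed V" and "z \<in> V"
  shows "norm (orth_proj V x - z) \<le> norm (x - z)"
proof -
  let ?p = "orth_proj V x"
  have "?p - z \<in> V"
    using subspace_diff[OF assms(1)] orth_proj_decomposition(1)[OF assms(1,2)] assms(3) by blast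
  then have "orthogonal (?p - z) (x - ?p)"
    using orth_proj_decomposition(2)[OF assms(1,2), of x] by (auto simp: orthogonal_comp_def)
  then have "(norm (x - z))\<^sup>2 = (norm (?p - z))\<^sup>2 + (norm (x - ?p))\<^sup>2"
    using norm_add_Pythagorean[of "?p - z" "x - ?p"] by simp
  then show ?thesis by (simp add: power2_le_imp_le)
qed

lemma orth_proj_self_adjoint_fixing:
  fixes V :: "'a::{real_inner, banach} set"
  assumes V: "subspace V" "closed V" and T: "self_adjoint T"
    and fixed: "\<And>u. u \<in> V \<Longrightarrow> blinfun_apply T u = u"
  shows "orth_proj V (blinfun_apply T y) = orth_proj V y"
proof (rule orth_proj_eqI[OF V(1) orth_proj_decomposition(1)[OF V]])
  have "u \<bullet> blinfun_apply T y = u \<bullet> y" if "u \<in> V" for u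
    using T fixed[OF that] unfolding self_adjoint_def by metis
  then show "blinfun_apply T y - orth_proj V y \<in> orthogonal_comp V"
    using orth_proj_decomposition(2)[OF V, of y]
    by (simp add: orthogonal_comp_def orthogonal_def inner_diff_right)
qed

section \<open>Unbiased linear estimators of a Gaussian mean\<close>

lemma gaussian_measure_weak_mean:
  assumes M: "gaussian_measure M \<mu> C" and "nonneg_op C"
  shows "(\<integral>y. b \<bullet> y \<partial>M) = b \<bullet> \<mu>"
proof -
  interpret prob_space M using M by (simp add: gaussian_measure_def)
  define v where "v = blinfun_apply C b \<bullet> b"
  have "v \<ge> 0" using assms(2) by (simp add: nonneg_op_def v_def)
  have "sets M = sets borel" using M by (simp add: gaussian_measure_def)
  have [measurable]: "(\<lambda>y. b \<bullet> y) \<in> borel_measurable M"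
    unfolding measurable_cong_sets[OF \<open>sets M = sets borel\<close> refl] by measurable
  have distr: "distr M borel (\<lambda>y. b \<bullet> y) = normal_dist (b \<bullet> \<mu>) v"
    using M by (simp add: gaussian_measure_def v_def)
  show ?thesis
  proof (cases "v = 0")
    case True
    have "(\<integral>y. b \<bullet> y \<partial>M) = (\<integral>x. x \<partial>distr M borel (\<lambda>y. b \<bullet> y))"
      by (simp add: integral_distr)
    also have "\<dots> = b \<bullet> \<mu>"
      using True by (simp add: distr normal_dist_def integral_return)
    finally show ?thesis .
  next
    case False
    have "distr M lborel (\<lambda>y. b \<bullet> y) = distr M borel (\<lambda>y. b \<bullet> y)"
      by (rule distr_cong) auto
    then have "distributed M lborel (\<lambda>y. b \<bullet> y) (normal_density (b \<bullet> \<mu>) (sqrt v))"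
      using False distr by (simp add: distributed_def normal_dist_def)
    then show ?thesis
      using False \<open>v \<ge> 0\<close> by (intro normal_distributed_expectation[of "sqrt v"]) auto
  qed
qed

text \<open>
  Testing the expectation of \<open>T Y\<close> against a vector \<open>b\<close> moves \<open>T\<close> to the other side of the inner
  product, so that only the law of \<open>\<langle>T b, Y\<rangle>\<close> is used and the Bochner integral of \<open>Y\<close> itself
  does not enter.
\<close>

lemma unbiased_linear_estimator_fixes_means:
  assumes M: "gaussian_measure M \<mu> C" and "nonneg_op C" and T: "self_adjoint T"
    and int: "integrable M (blinfun_apply T)" and mean: "(\<integral>y. blinfun_apply T y \<partial>M) = \<mu>"
  shows "blinfun_apply T \<mu> = \<mu>"
proof -
  have "b \<bullet> \<mu> = b \<bullet> blinfun_apply T \<mu>" for b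
  proof -
    have "b \<bullet> \<mu> = (\<integral>y. b \<bullet> blinfun_apply T y \<partial>M)"
      using int by (simp add: mean)
    also have "\<dots> = (\<integral>y. blinfun_apply T b \<bullet> y \<partial>M)"
      using T by (simp add: self_adjoint_def)
    also have "\<dots> = b \<bullet> blinfun_apply T \<mu>"
      unfolding gaussian_measure_weak_mean[OF M \<open>nonneg_op C\<close>]
      using T by (simp only: self_adjoint_def)
    finally show ?thesis .
  qed
  then show ?thesis
    using vector_eq_ldot[of \<mu> "blinfun_apply T \<mu>"] by simp
qed

section \<open>Minimality of the risk\<close>

theorem theorem3p3:
  fixes U :: "'a::{real_inner, banach, second_countable_topology} set"
    and Q T :: "'a \<Rightarrow>\<^sub>L 'a"
    and P :: "'a \<times> real \<Rightarrow> 'a measure"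
  assumes "subspace U" and "closed U"
    and "nonneg_op Q" and "self_adjoint Q" and "nuclear_op Q"
    and "invariant_under Q U" and "invariant_under Q (orthogonal_comp U)"
    and "\<And>\<zeta> \<sigma>. \<zeta> \<in> U \<Longrightarrow> \<sigma> > 0 \<Longrightarrow> gaussian_measure (P (\<zeta>, \<sigma>)) \<zeta> (\<sigma>\<^sup>2 *\<^sub>R Q)"
    and "self_adjoint T"
    and "unbiased (U \<times> {0<..}) P (blinfun_apply T)"
  shows "\<forall>\<theta> \<in> U \<times> {0<..}. risk P \<theta> (orth_proj U) \<le> risk P \<theta> (blinfun_apply T)"
proof
  fix \<theta> :: "'a \<times> real" assume \<theta>: "\<theta> \<in> U \<times> {0<..}"
  have fixed: "blinfun_apply T u = u" if "u \<in> U" for u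
  proof (rule unbiased_linear_estimator_fixes_means)
    show "gaussian_measure (P (u, 1)) u (1\<^sup>2 *\<^sub>R Q)"
      by (rule assms(8)[OF that zero_less_one])
    show "nonneg_op (1\<^sup>2 *\<^sub>R Q)" using assms(3) by simp
    show "integrable (P (u, 1)) (blinfun_apply T)" "(\<integral>y. blinfun_apply T y \<partial>P (u, 1)) = u"
      using assms(10) that by (auto simp: unbiased_def)
  qed (rule assms(9))
  have "fst \<theta> \<in> U" using \<theta> by (simp add: mem_Times_iff)
  have "norm (orth_proj U y - fst \<theta>) \<le> norm (blinfun_apply T y - fst \<theta>)" for y
  proof -
    have "orth_proj U (blinfun_apply T y) = orth_proj U y"
      by (rule orth_proj_self_adjoint_fixing[OF assms(1,2,9) fixed])
    then show ?thesis
      using norm_orth_proj_diff_le[OF assms(1,2) \<open>fst \<theta> \<in> U\<close>] by metis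
  qed
  then show "risk P \<theta> (orth_proj U) \<le> risk P \<theta> (blinfun_apply T)"
    unfolding risk_def by (intro nn_integral_mono ennreal_leI power_mono) auto
qed

end
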